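(* Let $\mathbf{G}_1$ and $\mathbf{G}_2$ be the directed graphs on the alphabet $A=\{X,Y,Z\}$ whose adjacency matrices (rows and columns ordered $X,Y,Z$) are $$M_1=\begin{bmatrix}1&1&1\\0&1&0\\1&1&0\end{bmatrix},\qquad M_2=\begin{bmatrix}0&1&0\\0&1&0\\1&1&1\end{bmatrix}.$$ Let $0=g_0<g_1<g_2<\cdots$ be an increasing sequence of non-negative integers and put $s_t=g_t-g_{t-1}$ for $t\ge 1$. Let $\mu=(1+\sqrt5)/2$. Let $\omega_1^n$ be the number of words of length $n$ generated by $\mathbf{G}_1$, and let $\omega_{\mathcal F}^n$ be the number of words of length $n$ generated by the dynamical system $\mathcal F$ that combines $\mathbf{G}_1$ and $\mathbf{G}_2$ according to the sequence $\{g_i\}$ (defined in the context). Then for every $t\ge1$, $$5^{-t/2}\prod_{i=1}^t\big[\mu^{s_{2i-1}}-(1-\mu)^{s_{2i-1}}\big]<\omega_{\mathcal F}^{g_{2t}}<\omega_1^{s_1+s_3+\cdots+s_{2t-1}}\Big[1+2\sum_{i=1}^t s_{2i}\Big].$$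
   Context: Adjacency matrix convention: the $(i,j)$ entry is $1$ if the graph has an arrow from the $i$-th vertex to the $j$-th vertex and $0$ otherwise. Let $\mathcal A_3$ be the set of all finite words (strings) over $A=\{X,Y,Z\}$. For a directed graph $\mathbf{G}$ on $A$ and a word $s\in\mathcal A_3$ with last letter $U$, a 1-letter extension of $s$ generated by $\mathbf{G}$ is a word $sV$ obtained by appending a letter $V\in A$ such that $\mathbf{G}$ has an arrow from $U$ to $V$. For $r=1,2$ the map $\mathcal G_r:2^{\mathcal A_3}\to 2^{\mathcal A_3}$ sends $S\subset\mathcal A_3$ to the set of all 1-letter extensions, generated by $\mathbf{G}_r$, of the words in $S$. The set of words of length $n$ generated by $\mathbf{G}_1$ is $\mathcal G_1^{\,n-1}(A)$ (the $(n-1)$-fold iterate applied to the set $A$ of one-letter words), i.e. the strings of length $n$ in which each consecutive pair $UV$ is an arrow from $U$ to $V$ in $\mathbf{G}_1$; its cardinality is $\omega_1^n$. The dynamical system $\mathcal F$ on $\mathbb N\times 2^{\mathcal A_3}$ (with $0\in\mathbb N$) is $$\mathcal F(m,S)=\begin{cases}(m+1,\mathcal G_1(S)) & \text{if } g_{2t}\le m<g_{2t+1},\ t=0,1,2,\dots\\ (m+1,\mathcal G_2(S)) & \text{if } g_{2t+1}\le m<g_{2t+2},\ t=0,1,2,\dots\end{cases}$$ The set of words of length $n$ generated by $\mathcal F$ is $\mathcal W_{\mathcal F}^n:=pr_2(\mathcal F^{n-1}(0,A))$, where $pr_2$ is the projection on the second coordinate, and $\omega_{\mathcal F}^n$ is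 its cardinality. In $\omega_1^n$ and $\omega_{\mathcal F}^n$ the superscript is an index (the word length), not an exponent. *)

theory Defs
  imports "HOL-Analysis.Analysis"
begin

datatype letter = X | Y | Z

type_synonym word = "letter list"

type_synonym digraph = "letter rel"

text \<open>The indices of type \<open>3\<close> are listed as 1, 2, 3, where \<open>3 = 0\<close>; this is the order
  in which \<^const>\<open>vector\<close> enumerates components.\<close>

definition vertex :: "3 \<Rightarrow> letter" where
  "vertex i = (if i = 1 then X else if i = 2 then Y else Z)"

definition adjacency_matrix :: "digraph \<Rightarrow> nat ^ 3 ^ 3" where
  "adjacency_matrix G = (\<chi> i j. if (vertex i, vertex j) \<in> G then 1 else 0)"

definition M1 :: "nat ^ 3 ^ 3" where
  "M1 = vector [vector [1, 1, 1],
                vector [0, 1, 0],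
                vector [1, 1, 0]]"

definition M2 :: "nat ^ 3 ^ 3" where
  "M2 = vector [vector [0, 1, 0],
                vector [0, 1, 0],
                vector [1, 1, 1]]"

definition one_letter_words :: "word set" where
  "one_letter_words = {[U] | U. True}"

text \<open>The empty word has no last letter, hence no 1-letter extension.\<close>

definition extensions :: "digraph \<Rightarrow> word set \<Rightarrow> word set" where
  "extensions G S = {s @ [V] | s V. s \<in> S \<and> s \<noteq> [] \<and> (last s, V) \<in> G}"

definition graph_words :: "digraph \<Rightarrow> nat \<Rightarrow> word set" where
  "graph_words G n = (extensions G ^^ (n - 1)) one_letter_words"

definition graph_word_count :: "digraph \<Rightarrow> nat \<Rightarrow> nat" where
  "graph_word_count G n = card (graph_words G n)"

text \<open>If \<open>g\<close> is strictly increasing with \<open>g 0 = 0\<close>, the intervals \<open>{g k..<g (Suc k)}\<close>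
  partition the natural numbers, so the else-branch is exactly the case
  \<open>g (2 * t + 1) \<le> m < g (2 * t + 2)\<close> for some \<open>t\<close>.\<close>

definition dyn_system ::
  "digraph \<Rightarrow> digraph \<Rightarrow> (nat \<Rightarrow> nat) \<Rightarrow> nat \<times> word set \<Rightarrow> nat \<times> word set" where
  "dyn_system G1 G2 g = (\<lambda>(m, S).
     if \<exists>t. g (2 * t) \<le> m \<and> m < g (2 * t + 1)
     then (m + 1, extensions G1 S)
     else (m + 1, extensions G2 S))"

definition dyn_words :: "digraph \<Rightarrow> digraph \<Rightarrow> (nat \<Rightarrow> nat) \<Rightarrow> nat \<Rightarrow> word set" where
  "dyn_words G1 G2 g n = snd ((dyn_system G1 G2 g ^^ (n - 1)) (0, one_letter_words))"

definition dyn_word_count :: "digraph \<Rightarrow> digraph \<Rightarrow> (nat \<Rightarrow> nat) \<Rightarrow> nat \<Rightarrow> nat" where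
  "dyn_word_count G1 G2 g n = card (dyn_words G1 G2 g n)"

text \<open>Only used for \<open>t \<ge> 1\<close> and increasing \<open>g\<close>, where the natural-number subtraction is exact.\<close>

definition gap :: "(nat \<Rightarrow> nat) \<Rightarrow> nat \<Rightarrow> nat" where
  "gap g t = g t - g (t - 1)"

definition golden_ratio :: real where
  "golden_ratio = (1 + sqrt 5) / 2"

end

theory Submission
  imports Defs "HOL-Number_Theory.Fib"
begin

text \<open>
  Count words by their last letter. Extending by \<open>G\<^sub>1\<close> maps the counts \<open>(x, y, z)\<close> to
  \<open>(x + z, x + y + z, x)\<close>, extending by \<open>G\<^sub>2\<close> maps them to \<open>(z, x + y + z, z)\<close>. Hence one block of
  \<open>a\<close> steps with \<open>G\<^sub>1\<close> followed by \<open>b \<ge> 1\<close> steps with \<open>G\<^sub>2\<close> maps \<open>(z, y, z)\<close> to \<open>(z', y', z')\<close> where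
  \<open>z' = z F\<^bsub>a+1\<^esub>\<close> and \<open>y' = y + z (F\<^bsub>a+5\<^esub> - 3) + 2 (b - 1) z'\<close>. As a step with \<open>G\<^sub>2\<close> turns the total
  count into the count of words ending in \<open>Y\<close>, the number of words of length \<open>g\<^bsub>2t\<^esub>\<close> is this \<open>y\<close>
  after \<open>t\<close> blocks. It exceeds \<open>z = \<Prod> F\<^bsub>s+1\<^esub>\<close>, which by Binet's formula gives the lower bound; the
  upper bound follows by induction on \<open>t\<close> from \<open>\<omega>\<^sub>1\<^sup>n = F\<^bsub>n+4\<^esub> - 2\<close> and \<open>F\<^bsub>m+1\<^esub> F\<^bsub>n+1\<^esub> \<le> F\<^bsub>m+n+1\<^esub>\<close>.
\<close>

section \<open>Word counts by last letter\<close>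

definition words_ending :: "word set \<Rightarrow> letter \<Rightarrow> word set" where
  "words_ending S U = {s \<in> S. s \<noteq> [] \<and> last s = U}"

text \<open>Excluding the empty word makes the three classes cover \<open>S\<close>; finiteness
  keeps \<open>card\<close> meaningful.\<close>

definition has_counts :: "word set \<Rightarrow> nat \<Rightarrow> nat \<Rightarrow> nat \<Rightarrow> bool" where
  "has_counts S x y z \<longleftrightarrow> finite S \<and> [] \<notin> S \<and>
     card (words_ending S X) = x \<and> card (words_ending S Y) = y \<and> card (words_ending S Z) = z"

lemma letter_UNIV: "UNIV = {X, Y, Z}"
  using letter.exhaust by auto

lemma has_counts_card:
  assumes "has_counts S x y z"
  shows "card S = x + y + z"
proof -
  have "S = (\<Union>U\<in>{X, Y, Z}. words_ending S U)"
    using assms letter_UNIV by (auto simp: words_ending_def has_counts_def)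
  moreover have "card (\<Union>U\<in>{X, Y, Z}. words_ending S U) = (\<Sum>U\<in>{X, Y, Z}. card (words_ending S U))"
    using assms by (intro card_UN_disjoint) (auto simp: words_ending_def has_counts_def)
  ultimately show ?thesis
    using assms by (simp add: has_counts_def)
qed

lemma has_counts_one_letter_words: "has_counts one_letter_words 1 1 1"
proof -
  have eq: "one_letter_words = {[X], [Y], [Z]}"
    using letter_UNIV by (auto simp: one_letter_words_def)
  have "words_ending {[X], [Y], [Z]} U = {[U]}" for U
    by (cases U) (auto simp: words_ending_def)
  then show ?thesis
    by (simp add: has_counts_def eq)
qed

text \<open>Appending a fixed \<open>V\<close> is injective and the classes by last letter are
  disjoint, so a step acts on the counts as the transposed adjacency matrix.\<close>

lemma card_words_ending_extensions:
  assumes "finite S"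
  shows "card (words_ending (extensions G S) V) = (\<Sum>U | (U, V) \<in> G. card (words_ending S U))"
proof -
  have "finite (UNIV :: letter set)"
    by (simp add: letter_UNIV)
  then have fin: "finite (A :: letter set)" for A
    by (rule rev_finite_subset) simp
  have "words_ending (extensions G S) V = (\<lambda>s. s @ [V]) ` (\<Union>U\<in>{U. (U, V) \<in> G}. words_ending S U)"
    by (auto simp: words_ending_def extensions_def)
  moreover have "inj_on (\<lambda>s. s @ [V]) A" for A
    by (simp add: inj_on_def)
  ultimately have "card (words_ending (extensions G S) V)
      = card (\<Union>U\<in>{U. (U, V) \<in> G}. words_ending S U)"
    by (simp add: card_image)
  also have "\<dots> = (\<Sum>U | (U, V) \<in> G. card (words_ending S U))"
    using assms fin by (intro card_UN_disjoint) (auto simp: words_ending_def)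
  finally show ?thesis .
qed

lemma finite_extensions:
  assumes "finite S"
  shows "finite (extensions G S)"
proof (rule finite_subset)
  show "extensions G S \<subseteq> (\<lambda>(s, V). s @ [V]) ` (S \<times> {X, Y, Z})"
    using letter_UNIV by (fastforce simp: extensions_def image_iff)
qed (use assms in simp)

lemma edge_iff:
  assumes "adjacency_matrix G = M"
  shows "(vertex i, vertex j) \<in> G \<longleftrightarrow> M $ i $ j = 1"
  unfolding assms[symmetric] by (simp add: adjacency_matrix_def)

lemma vertex_simps: "vertex 1 = X" "vertex 2 = Y" "vertex 3 = Z"
  by (simp_all add: vertex_def)

lemma has_counts_extensions_M1:
  assumes "adjacency_matrix G = M1" and "has_counts S x y z"
  shows "has_counts (extensions G S) (x + z) (x + y + z) x"
proof -
  note e = edge_iff[OF assms(1)]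
  have edges: "(X, X) \<in> G" "(X, Y) \<in> G" "(X, Z) \<in> G" "(Y, X) \<notin> G" "(Y, Y) \<in> G" "(Y, Z) \<notin> G"
    "(Z, X) \<in> G" "(Z, Y) \<in> G" "(Z, Z) \<notin> G"
    using e[of 1 1] e[of 1 2] e[of 1 3] e[of 2 1] e[of 2 2] e[of 2 3] e[of 3 1] e[of 3 2] e[of 3 3]
    by (simp_all only: vertex_simps M1_def vector_3 simp_thms one_neq_zero zero_neq_one)
  have "(U, X) \<in> G \<longleftrightarrow> U \<in> {X, Z}" "(U, Y) \<in> G \<longleftrightarrow> U \<in> {X, Y, Z}" "(U, Z) \<in> G \<longleftrightarrow> U \<in> {X}" for U
    by (cases U; simp add: edges)+
  then have "{U. (U, X) \<in> G} = {X, Z}" "{U. (U, Y) \<in> G} = {X, Y, Z}" "{U. (U, Z) \<in> G} = {X}"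
    by auto
  then show ?thesis
    using assms(2) finite_extensions[of S G] card_words_ending_extensions[of S G]
    by (auto simp: has_counts_def extensions_def)
qed

lemma has_counts_extensions_M2:
  assumes "adjacency_matrix G = M2" and "has_counts S x y z"
  shows "has_counts (extensions G S) z (x + y + z) z"
proof -
  note e = edge_iff[OF assms(1)]
  have edges: "(X, X) \<notin> G" "(X, Y) \<in> G" "(X, Z) \<notin> G" "(Y, X) \<notin> G" "(Y, Y) \<in> G" "(Y, Z) \<notin> G"
    "(Z, X) \<in> G" "(Z, Y) \<in> G" "(Z, Z) \<in> G"
    using e[of 1 1] e[of 1 2] e[of 1 3] e[of 2 1] e[of 2 2] e[of 2 3] e[of 3 1] e[of 3 2] e[of 3 3]
    by (simp_all only: vertex_simps M2_def vector_3 simp_thms one_neq_zero zero_neq_one)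
  have "(U, X) \<in> G \<longleftrightarrow> U \<in> {Z}" "(U, Y) \<in> G \<longleftrightarrow> U \<in> {X, Y, Z}" "(U, Z) \<in> G \<longleftrightarrow> U \<in> {Z}" for U
    by (cases U; simp add: edges)+
  then have "{U. (U, X) \<in> G} = {Z}" "{U. (U, Y) \<in> G} = {X, Y, Z}" "{U. (U, Z) \<in> G} = {Z}"
    by auto
  then show ?thesis
    using assms(2) finite_extensions[of S G] card_words_ending_extensions[of S G]
    by (auto simp: has_counts_def extensions_def)
qed

section \<open>Closed forms for runs of steps with one graph\<close>

lemma fib_ge: "3 \<le> fib (n + 4)" "fib (n + 1) + 4 \<le> fib (n + 5)" "1 \<le> fib (n + 1)"
  by (induction n rule: fib.induct) (auto simp: numeral_eq_Suc)

text \<open>The left side is the total count after \<open>a\<close> steps with \<open>G1\<close>,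
  which the first \<open>G2\<close> step turns into the count for \<open>Y\<close>.\<close>

lemma block_total_eq:
  "z * fib (a + 2) + (y + z * (fib (a + 4) - 3)) + z * fib (a + 1) = y + z * (fib (a + 5) - 3)"
proof -
  have "fib (a + 5) - 3 = fib (a + 2) + (fib (a + 4) - 3) + fib (a + 1)"
    using fib_ge(1)[of a] by (simp add: numeral_eq_Suc)
  then show ?thesis
    by (simp only: add_mult_distrib2 ac_simps)
qed

text \<open>The counts for \<open>X\<close> and \<open>Z\<close> follow the Fibonacci recursion.
  Step \<open>k + 1\<close> adds \<open>z * fib (k + 3)\<close> to the count for \<open>Y\<close>;
  these sum to \<open>z * (fib (a + 4) - fib 4)\<close>, and \<open>fib 4 = 3\<close>.\<close>

lemma has_counts_extensions_M1_funpow: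
  assumes "adjacency_matrix G = M1" and "has_counts S z y z"
  shows "has_counts ((extensions G ^^ a) S)
           (z * fib (a + 2)) (y + z * (fib (a + 4) - 3)) (z * fib (a + 1))"
proof (induction a)
  case 0
  then show ?case
    using assms(2) by (simp add: numeral_eq_Suc)
next
  case (Suc a)
  show ?case
    using has_counts_extensions_M1[OF assms(1) Suc] unfolding block_total_eq[of z a y]
    by (simp add: numeral_eq_Suc algebra_simps)
qed

text \<open>After the first step the counts for \<open>X\<close> and \<open>Z\<close> both stay at
  \<open>z\<close>, so each of the other \<open>b - 1\<close> steps adds \<open>2 * z\<close> to the
  count for \<open>Y\<close>.\<close>

lemma has_counts_extensions_M2_funpow:
  assumes "adjacency_matrix G = M2" and "has_counts S x y z" and "b \<ge> 1"
  shows "has_counts ((extensions G ^^ b) S) z (x + y + z + 2 * (b - 1) * z) z"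
  using assms(3)
proof (induction b rule: dec_induct)
  case base
  then show ?case
    using has_counts_extensions_M2[OF assms(1,2)] by simp
next
  case (step b)
  then show ?case
    using has_counts_extensions_M2[OF assms(1) step.IH]
    by (cases b) (simp_all add: algebra_simps)
qed

text \<open>Equal counts for \<open>X\<close> and \<open>Z\<close> are restored at the end of a
  block, so blocks can be iterated.\<close>

lemma has_counts_block:
  assumes "adjacency_matrix G1 = M1" and "adjacency_matrix G2 = M2"
    and "has_counts S z y z" and "b \<ge> 1"
  shows "has_counts ((extensions G2 ^^ b) ((extensions G1 ^^ a) S))
           (z * fib (a + 1)) (y + z * (fib (a + 5) - 3) + 2 * (b - 1) * (z * fib (a + 1)))
           (z * fib (a + 1))"
  using has_counts_extensions_M2_funpow[OF assms(2)
    has_counts_extensions_M1_funpow[OF assms(1,3)] assms(4)]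
  unfolding block_total_eq .

lemma graph_word_count_M1:
  assumes "adjacency_matrix G = M1" and "n \<ge> 1"
  shows "graph_word_count G n = fib (n + 4) - 2"
proof -
  obtain m where n: "n = Suc m"
    using assms(2) by (cases n) auto
  have "graph_word_count G n = fib (m + 2) + (1 + (fib (m + 4) - 3)) + fib (m + 1)"
    using has_counts_card[OF has_counts_extensions_M1_funpow[OF assms(1) has_counts_one_letter_words]]
    by (simp add: graph_word_count_def graph_words_def n)
  also have "\<dots> = fib (n + 4) - 2"
    using fib_ge(1)[of m] by (simp add: n numeral_eq_Suc)
  finally show ?thesis .
qed

section \<open>Block structure of the dynamical system\<close>

text \<open>Indexed by the clock value \<open>m\<close> rather than by the word length, which is
  \<open>m + 1\<close>.\<close>

definition dyn_state :: "digraph \<Rightarrow> digraph \<Rightarrow> (nat \<Rightarrow> nat) \<Rightarrow> nat \<Rightarrow> word set" where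
  "dyn_state G1 G2 g m = snd ((dyn_system G1 G2 g ^^ m) (0, one_letter_words))"

lemma dyn_state_0 [simp]: "dyn_state G1 G2 g 0 = one_letter_words"
  by (simp add: dyn_state_def)

lemma fst_dyn_system_funpow: "fst ((dyn_system G1 G2 g ^^ m) (k, S)) = m + k"
  by (induction m) (simp_all add: dyn_system_def split_beta)

lemma snd_dyn_system:
  "snd (dyn_system G1 G2 g p) =
     (if \<exists>t. g (2 * t) \<le> fst p \<and> fst p < g (2 * t + 1)
      then extensions G1 (snd p) else extensions G2 (snd p))"
  by (cases p) (simp only: dyn_system_def prod.case fst_conv snd_conv if_distrib[of snd])

lemma dyn_state_Suc:
  "dyn_state G1 G2 g (Suc m) =
     (if \<exists>t. g (2 * t) \<le> m \<and> m < g (2 * t + 1)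
      then extensions G1 (dyn_state G1 G2 g m) else extensions G2 (dyn_state G1 G2 g m))"
  by (simp only: dyn_state_def snd_dyn_system fst_dyn_system_funpow funpow.simps comp_apply add_0_right)

lemma dyn_state_G1_block:
  assumes "g (2 * t) + k \<le> g (2 * t + 1)"
  shows "dyn_state G1 G2 g (g (2 * t) + k) = (extensions G1 ^^ k) (dyn_state G1 G2 g (g (2 * t)))"
  using assms
proof (induction k)
  case (Suc k)
  then have "\<exists>t'. g (2 * t') \<le> g (2 * t) + k \<and> g (2 * t) + k < g (2 * t' + 1)"
    by (intro exI[of _ t]) simp
  with Suc show ?case
    by (simp add: dyn_state_Suc)
qed simp

lemma in_G2_block:
  fixes g :: "nat \<Rightarrow> nat"
  assumes "strict_mono g" and "g (2 * t + 1) \<le> m" and "m < g (2 * t + 2)"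
  shows "\<not> (\<exists>t'. g (2 * t') \<le> m \<and> m < g (2 * t' + 1))"
proof
  assume "\<exists>t'. g (2 * t') \<le> m \<and> m < g (2 * t' + 1)"
  then obtain t' where "g (2 * t') \<le> m" "m < g (2 * t' + 1)"
    by blast
  with assms have "g (2 * t') < g (2 * t + 2)" "g (2 * t + 1) < g (2 * t' + 1)"
    by linarith+
  \<comment> \<open>Strict monotonicity turns these into \<open>2 * t' < 2 * t + 2\<close> and
    \<open>2 * t + 1 < 2 * t' + 1\<close>, that is \<open>t < t' < t + 1\<close>.\<close>
  then show False
    by (simp add: strict_mono_less[OF assms(1)])
qed

lemma dyn_state_G2_block:
  assumes "strict_mono g" and "g (2 * t + 1) + k \<le> g (2 * t + 2)"
  shows "dyn_state G1 G2 g (g (2 * t + 1) + k)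
           = (extensions G2 ^^ k) (dyn_state G1 G2 g (g (2 * t + 1)))"
  using assms(2)
proof (induction k)
  case (Suc k)
  then have "\<not> (\<exists>t'. g (2 * t') \<le> g (2 * t + 1) + k \<and> g (2 * t + 1) + k < g (2 * t' + 1))"
    by (intro in_G2_block[OF assms(1), of t]) simp_all
  then have "dyn_state G1 G2 g (Suc (g (2 * t + 1) + k))
      = extensions G2 (dyn_state G1 G2 g (g (2 * t + 1) + k))"
    unfolding dyn_state_Suc by (rule if_not_P)
  with Suc show ?case
    by simp
qed simp

lemma dyn_state_block:
  assumes "strict_mono g"
  shows "dyn_state G1 G2 g (g (2 * Suc t)) =
    (extensions G2 ^^ gap g (2 * Suc t))
      ((extensions G1 ^^ gap g (2 * Suc t - 1)) (dyn_state G1 G2 g (g (2 * t))))"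
proof -
  have "g (2 * t) < g (2 * t + 1)" "g (2 * t + 1) < g (2 * t + 2)"
    using strict_mono_less[OF assms] by simp_all
  then show ?thesis
    using dyn_state_G1_block[of g t "gap g (2 * t + 1)" G1 G2]
      dyn_state_G2_block[OF assms, of t "gap g (2 * t + 2)" G1 G2]
    by (simp add: gap_def)
qed

lemma gap_pos:
  assumes "strict_mono g" and "k \<ge> 1"
  shows "gap g k \<ge> 1"
  using strict_monoD[OF assms(1), of "k - 1" k] assms(2) by (simp add: gap_def)

text \<open>Words of length \<open>g (2 * t)\<close> form the state at clock
  \<open>g (2 * t) - 1\<close>. The next step uses \<open>G2\<close> and turns their total into the
  count for \<open>Y\<close> at clock \<open>g (2 * t)\<close>.\<close>

lemma dyn_word_count_M2:
  assumes "adjacency_matrix G2 = M2" and "strict_mono g" and "t \<ge> 1"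
    and "has_counts (dyn_state G1 G2 g (g (2 * t))) x y z"
    and "has_counts (dyn_state G1 G2 g (g (2 * t) - 1)) x' y' z'"
  shows "dyn_word_count G1 G2 g (g (2 * t)) = y"
proof -
  obtain u where t: "t = Suc u"
    using assms(3) by (cases t) auto
  have less: "g (2 * u + 1) < g (2 * t)"
    using strict_mono_less[OF assms(2)] t by simp
  then have "\<not> (\<exists>t'. g (2 * t') \<le> g (2 * t) - 1 \<and> g (2 * t) - 1 < g (2 * t' + 1))"
    by (intro in_G2_block[OF assms(2), of u]) (simp_all add: t)
  then have "dyn_state G1 G2 g (Suc (g (2 * t) - 1)) = extensions G2 (dyn_state G1 G2 g (g (2 * t) - 1))"
    unfolding dyn_state_Suc by (rule if_not_P)
  with less have "has_counts (dyn_state G1 G2 g (g (2 * t))) z' (x' + y' + z') z'"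
    using has_counts_extensions_M2[OF assms(1,5)] by simp
  then have "y = x' + y' + z'"
    using assms(4) by (simp add: has_counts_def)
  with has_counts_card[OF assms(5)] show ?thesis
    by (simp add: dyn_word_count_def dyn_words_def dyn_state_def)
qed

section \<open>Bounds on the counts after \<open>t\<close> blocks\<close>

lemma fib_mult_le: "fib (m + 1) * fib (n + 1) \<le> fib (m + n + 1)"
  using fib_add[of m n] by simp

text \<open>Inductive step of the upper bound. With \<open>W\<close> the number of
  \<open>G1\<close>-words of length \<open>A + a\<close>, the three summands are at most
  \<open>W * (1 + 2 * B)\<close>, less than \<open>2 * W\<close>, and at most
  \<open>2 * (b - 1) * W\<close>.\<close>

lemma block_upper_bound:
  assumes "z \<ge> 1" "z \<le> fib (A + 1)" "b \<ge> 1" "a \<ge> 1"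
    and y: "y \<le> (fib (A + 4) - 2) * (1 + 2 * B)"
  shows "y + z * (fib (a + 5) - 3) + 2 * (b - 1) * (z * fib (a + 1))
           < (fib (A + a + 4) - 2) * (1 + 2 * (B + b))"
proof -
  define W where "W = fib (A + a + 4) - 2"
  have mono: "fib (A + 4) - 2 \<le> W"
    unfolding W_def by (intro diff_le_mono fib_mono) simp
  have y': "y \<le> W * (1 + 2 * B)"
    using y mult_right_mono[OF mono, of "1 + 2 * B"] by linarith
  have "z * fib (a + 5) \<le> fib (A + 1) * fib (a + 4 + 1)"
    using assms(2) by (simp add: add.commute)
  also have "\<dots> \<le> fib (A + a + 5)"
    using fib_mult_le[of A "a + 4"] by (simp add: algebra_simps)
  finally have "z * fib (a + 5) \<le> fib (A + a + 5)" .
  \<comment> \<open>Since \<open>z \<ge> 1\<close>, at least 3 is subtracted when the product is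
    expanded.\<close>
  then have 1: "z * (fib (a + 5) - 3) \<le> fib (A + a + 5) - 3"
    using assms(1) by (simp add: diff_mult_distrib2)
  have f: "fib (A + a + 5) = fib (A + a + 4) + fib (A + a + 3)"
    "fib (A + a + 4) = fib (A + a + 3) + fib (A + a + 2)"
    "fib (A + a + 3) = fib (A + a + 2) + fib (A + a + 1)"
    by (simp_all add: numeral_eq_Suc)
  have "fib (A + a + 1) \<ge> 1"
    by (rule fib_ge(3))
  \<comment> \<open>The gap between \<open>2 * W\<close> and \<open>fib (A + a + 5) - 3\<close> is
    \<open>fib (A + a + 2) - 1\<close>, positive because \<open>a \<ge> 1\<close>.\<close>
  moreover have "fib 3 \<le> fib (A + a + 2)"
    using assms(4) by (intro fib_mono) simp
  moreover have "fib 3 = 2"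
    by (simp add: numeral_eq_Suc)
  ultimately have f2: "fib (A + a + 5) - 3 < 2 * W" "fib (A + a + 1) \<le> W"
    using f unfolding W_def by linarith+
  have "z * fib (a + 1) \<le> fib (A + 1) * fib (a + 1)"
    using assms(2) by simp
  also have "\<dots> \<le> W"
    using fib_mult_le[of A a] f2(2) by linarith
  finally have "2 * (b - 1) * (z * fib (a + 1)) \<le> 2 * (b - 1) * W"
    by simp
  with 1 f2(1) y' have "y + z * (fib (a + 5) - 3) + 2 * (b - 1) * (z * fib (a + 1))
      < W * (1 + 2 * B) + 2 * W + 2 * (b - 1) * W"
    by linarith
  also have "\<dots> = W * (1 + 2 * (B + b))"
    using assms(3) by (cases b) (simp_all add: algebra_simps)
  finally show ?thesis
    by (simp add: W_def)
qed

text \<open>At \<open>t = 0\<close> both \<open>P t\<close> and the upper bound equal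
  \<open>y = 1\<close>, so the induction carries weak bounds and claims strict ones only from
  \<open>t = 1\<close> on.\<close>

lemma dyn_state_counts:
  fixes g :: "nat \<Rightarrow> nat"
  assumes "adjacency_matrix G1 = M1" and "adjacency_matrix G2 = M2"
    and "g 0 = 0" and "strict_mono g"
  defines "P \<equiv> \<lambda>t. \<Prod>i=1..t. fib (gap g (2 * i - 1) + 1)"
    and "A \<equiv> \<lambda>t. \<Sum>i=1..t. gap g (2 * i - 1)"
    and "B \<equiv> \<lambda>t. \<Sum>i=1..t. gap g (2 * i)"
  shows "\<exists>y. has_counts (dyn_state G1 G2 g (g (2 * t))) (P t) y (P t) \<and>
     1 \<le> P t \<and> P t \<le> fib (A t + 1) \<and> 1 \<le> y \<and> y \<le> (fib (A t + 4) - 2) * (1 + 2 * B t) \<and>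
     (t \<ge> 1 \<longrightarrow> P t < y \<and> y < (fib (A t + 4) - 2) * (1 + 2 * B t))"
proof (induction t)
  case 0
  then show ?case
    using has_counts_one_letter_words assms(3)
    by (auto simp: P_def A_def B_def numeral_eq_Suc)
next
  case (Suc t)
  then obtain y where y: "has_counts (dyn_state G1 G2 g (g (2 * t))) (P t) y (P t)"
    "1 \<le> P t" "P t \<le> fib (A t + 1)" "1 \<le> y" "y \<le> (fib (A t + 4) - 2) * (1 + 2 * B t)"
    by blast
  define a b where "a = gap g (2 * Suc t - 1)" and "b = gap g (2 * Suc t)"
  define y' where "y' = y + P t * (fib (a + 5) - 3) + 2 * (b - 1) * (P t * fib (a + 1))"
  have ab: "a \<ge> 1" "b \<ge> 1"
    unfolding a_def b_def by (rule gap_pos[OF assms(4)]; simp)+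
  have Suc_eq: "P (Suc t) = P t * fib (a + 1)" "A (Suc t) = A t + a" "B (Suc t) = B t + b"
    by (simp_all add: P_def A_def B_def a_def b_def)
  have "has_counts (dyn_state G1 G2 g (g (2 * Suc t))) (P (Suc t)) y' (P (Suc t))"
    using has_counts_block[OF assms(1,2) y(1) ab(2)] dyn_state_block[OF assms(4)]
    by (simp add: Suc_eq y'_def a_def b_def)
  moreover have "1 \<le> P (Suc t)"
    using y(2) fib_ge(3)[of a] by (simp add: Suc_eq)
  moreover have "P (Suc t) \<le> fib (A (Suc t) + 1)"
    unfolding Suc_eq using order_trans[OF mult_right_mono[OF y(3)] fib_mult_le] by blast
  moreover have "P (Suc t) < y'"
  proof -
    \<comment> \<open>The middle summand of \<open>y'\<close> already reaches
      \<open>P (Suc t)\<close>; \<open>y \<ge> 1\<close> makes the inequality strict.\<close>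
    have "P t * fib (a + 1) \<le> P t * (fib (a + 5) - 3)"
      using fib_ge(2)[of a] by (intro mult_left_mono) auto
    then show ?thesis
      using y(4) unfolding Suc_eq y'_def by linarith
  qed
  moreover have "y' < (fib (A (Suc t) + 4) - 2) * (1 + 2 * B (Suc t))"
    unfolding Suc_eq y'_def by (rule block_upper_bound[OF y(2,3) ab(2,1) y(5)])
  ultimately show ?case
    by (intro exI[of _ y']) linarith
qed

lemma has_counts_dyn_state:
  assumes "adjacency_matrix G1 = M1" and "adjacency_matrix G2 = M2"
  shows "\<exists>x y z. has_counts (dyn_state G1 G2 g m) x y z"
proof (induction m)
  case 0
  then show ?case
    using has_counts_one_letter_words by auto
next
  case (Suc m)
  then obtain x y z where "has_counts (dyn_state G1 G2 g m) x y z"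
    by blast
  from has_counts_extensions_M1[OF assms(1) this] has_counts_extensions_M2[OF assms(2) this]
  show ?case
    unfolding dyn_state_Suc by (auto split: if_splits)
qed

text \<open>By Binet's formula each factor is \<open>sqrt 5 * fib (s i)\<close>, and the
  \<open>t\<close> factors \<open>sqrt 5\<close> cancel the power of 5.\<close>

lemma golden_ratio_prod_eq:
  "5 powr (- real t / 2) * (\<Prod>i=1..t. golden_ratio ^ s i - (1 - golden_ratio) ^ s i)
     = real (\<Prod>i=1..t. fib (s i))"
proof -
  have conj: "1 - golden_ratio = (1 - sqrt 5) / 2"
    by (simp add: golden_ratio_def field_simps)
  have "golden_ratio ^ n - (1 - golden_ratio) ^ n = sqrt 5 * real (fib n)" for n
    unfolding conj using fib_closed_form[of n] by (simp add: golden_ratio_def)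
  then have "(\<Prod>i=1..t. golden_ratio ^ s i - (1 - golden_ratio) ^ s i)
      = sqrt 5 ^ t * real (\<Prod>i=1..t. fib (s i))"
    by (simp add: prod.distrib)
  moreover have "5 powr (- real t / 2) * sqrt 5 ^ t = 1"
  proof -
    have "sqrt 5 ^ t = 5 powr (real t / 2)"
      by (simp add: powr_half_sqrt[symmetric] powr_realpow[symmetric] powr_powr)
    then show ?thesis
      by (simp add: powr_add[symmetric])
  qed
  ultimately show ?thesis
    by (simp add: mult.assoc[symmetric])
qed

theorem theorem3:
  fixes G1 G2 :: digraph and g :: "nat \<Rightarrow> nat" and t :: nat
  assumes "adjacency_matrix G1 = M1"
    and "adjacency_matrix G2 = M2"
    and "g 0 = 0"
    and "strict_mono g"
    and "t \<ge> 1"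
  shows "5 powr (- real t / 2) *
           (\<Prod>i=1..t. golden_ratio ^ gap g (2 * i - 1) - (1 - golden_ratio) ^ gap g (2 * i - 1))
         < real (dyn_word_count G1 G2 g (g (2 * t)))
       \<and> dyn_word_count G1 G2 g (g (2 * t))
         < graph_word_count G1 (\<Sum>i=1..t. gap g (2 * i - 1)) * (1 + 2 * (\<Sum>i=1..t. gap g (2 * i)))"
proof -
  define P where "P = (\<Prod>i=1..t. fib (gap g (2 * i - 1) + 1))"
  define A where "A = (\<Sum>i=1..t. gap g (2 * i - 1))"
  define B where "B = (\<Sum>i=1..t. gap g (2 * i))"
  obtain y where y: "has_counts (dyn_state G1 G2 g (g (2 * t))) P y P"
    "P < y" "y < (fib (A + 4) - 2) * (1 + 2 * B)"
    using dyn_state_counts[OF assms(1-4), of t] assms(5) unfolding P_def A_def B_def by blast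
  have count: "dyn_word_count G1 G2 g (g (2 * t)) = y"
    using has_counts_dyn_state[OF assms(1,2)] dyn_word_count_M2[OF assms(2,4,5) y(1)] by blast
  \<comment> \<open>The stated lower bound has \<open>fib s\<close> where \<open>P\<close> has
    \<open>fib (s + 1)\<close>.\<close>
  have "(\<Prod>i=1..t. fib (gap g (2 * i - 1))) \<le> P"
    unfolding P_def by (intro prod_mono) (simp add: fib_mono)
  \<comment> \<open>The closed form for the \<open>G1\<close>-words fails at length 0, where
    truncated subtraction in \<open>graph_words\<close> yields the three one-letter words.\<close>
  moreover have "A \<ge> 1"
    using gap_pos[OF assms(4), of 1] assms(5) member_le_sum[of 1 "{1..t}" "\<lambda>i. gap g (2 * i - 1)"]
    by (simp add: A_def)
  ultimately show ?thesis
    using y(2,3) count graph_word_count_M1[OF assms(1)]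
    unfolding golden_ratio_prod_eq[of t "\<lambda>i. gap g (2 * i - 1)"] A_def[symmetric] B_def[symmetric]
    by (metis of_nat_less_iff order_le_less_trans)
qed

end
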